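(* The polynomials $F_n(t)$ satisfy the identity of formal power series in $t$ and $u$ $$\sum_{n\geq 0}F_n(t)\frac{u^n}{(1-t)^{n+1}}=\sum_{m\geq 0}t^m\frac{(1+u)^{m+1}}{(1+u^2)^{\binom{m+2}{2}}}.$$
   Context: Let $S_n$ be the symmetric group on $[n]=\{1,\dots,n\}$ and $\mathscr{I}_n\subseteq S_n$ the set of involutions, i.e. permutations $\sigma$ with $\sigma^2=\mathrm{id}$ (the identity included). For $\sigma\in S_n$, $\mathrm{ris}(\sigma)$ is the number of rises of $\sigma$, i.e. the number of $i\in\{1,\dots,n-1\}$ with $\sigma(i)<\sigma(i+1)$, and $\mathrm{sgn}(\sigma)\in\{1,-1\}$ is the sign of $\sigma$. The signed Eulerian polynomial on involutions is $$F_n(t)=\sum_{\sigma\in\mathscr{I}_n}\mathrm{sgn}(\sigma)\,t^{\mathrm{ris}(\sigma)},$$ with $F_0(t)=1$ (the empty permutation). *)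

theory Defs
  imports
    "HOL-Computational_Algebra.Computational_Algebra"
    "HOL-Combinatorics.Permutations"
begin

definition involutions :: "nat \<Rightarrow> (nat \<Rightarrow> nat) set" where
  "involutions n = {\<sigma>. \<sigma> permutes {1..n} \<and> \<sigma> \<circ> \<sigma> = id}"

definition ris :: "nat \<Rightarrow> (nat \<Rightarrow> nat) \<Rightarrow> nat" where
  "ris n \<sigma> = card {i \<in> {1..<n}. \<sigma> i < \<sigma> (i + 1)}"

definition signed_eulerian_inv :: "nat \<Rightarrow> int poly" where
  "signed_eulerian_inv n = (\<Sum>\<sigma>\<in>involutions n. monom (sign \<sigma>) (ris n \<sigma>))"

text \<open>
  Power series in the two variables \<open>t\<close> and \<open>u\<close> with rational coefficients are represented as
  power series in \<open>u\<close> whose coefficients are power series in \<open>t\<close>; the coefficient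
  of \<open>t ^ j * u ^ i\<close> in \<open>f\<close> is \<open>f $ i $ j\<close>.
\<close>

type_synonym bifps = "rat fps fps"

definition var_t :: bifps where
  "var_t = fps_const fps_X"

definition var_u :: bifps where
  "var_u = fps_X"

text \<open>
  The topology that the library puts on \<^typ>\<open>rat fps fps\<close> is the \<open>u\<close>-adic one, with discrete
  coefficients; in it a series such as \<open>\<Sum>m. t ^ m\<close> does not converge. Infinite sums
  of bivariate series are therefore taken coefficientwise: a family is summable if every monomial
  occurs with nonzero coefficient in only finitely many members.
\<close>

definition bifps_summable :: "(nat \<Rightarrow> bifps) \<Rightarrow> bool" where
  "bifps_summable f \<longleftrightarrow> (\<forall>i j. finite {n. f n $ i $ j \<noteq> 0})"

definition bifps_suminf :: "(nat \<Rightarrow> bifps) \<Rightarrow> bifps" where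
  "bifps_suminf f = Abs_fps (\<lambda>i. Abs_fps (\<lambda>j. \<Sum>n | f n $ i $ j \<noteq> 0. f n $ i $ j))"

text \<open>
  The coefficient ring \<^typ>\<open>rat fps\<close> is not a field, so the library's division on
  \<^typ>\<open>rat fps fps\<close> is not exact in general. It is for denominators with nonzero constant term:
\<close>

lemma bifps_divide_mult_cancel:
  fixes f g :: bifps
  assumes "g $ 0 $ 0 \<noteq> 0"
  shows "f / g * g = f"
proof -
  have 0: "g $ 0 \<noteq> 0" using assms by auto
  then have s: "subdegree g = 0" by simp
  have "g $ 0 * inverse (g $ 0) = 1"
    using assms by (simp add: inverse_mult_eq_1')
  then have "g * inverse g = 1"
    unfolding fps_inverse_def by (rule fps_right_inverse)
  moreover have "f / g = f * inverse g"
    using s by (simp add: fps_divide_def fps_unit_factor_def)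
  ultimately show ?thesis
    by (simp add: mult.assoc mult.commute[of "inverse g"])
qed

end

theory Submission
  imports Defs "HOL-Library.Product_Lexorder"
begin

text \<open>
  The coefficient of \<open>t ^ m * u ^ n\<close> on both sides counts, with signs, the same objects.

  On the left, \<open>t ^ ris \<sigma> / (1 - t) ^ (n + 1)\<close> is the generating function in \<open>m\<close> of the weakly
  increasing words \<open>a\<close> of length \<open>n\<close> over \<open>{0..m}\<close> that increase strictly wherever \<open>\<sigma>\<close> rises
  (\<open>labelings_generating_function\<close>). So the left coefficient is the sum of \<open>sign \<sigma>\<close> over all pairs
  of an involution \<open>\<sigma>\<close> and such a labeling \<open>a\<close>.

  To a pair \<open>(\<sigma>, a)\<close> belongs the matrix whose entry at \<open>(i, j)\<close> is the number of positions \<open>k\<close>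
  with \<open>a k = i\<close> and \<open>a (\<sigma> k) = j\<close>. It is symmetric because \<open>\<sigma>\<close> is an involution. A labeling is
  constant only on runs where \<open>\<sigma>\<close> decreases, so among the positions labeled \<open>i\<close> those sent to the
  label \<open>j\<close> come before those sent to a smaller label, and each such group is mapped in
  decreasing order. Hence the matrix determines the pair, and conversely every symmetric matrix
  of nonnegative integers with entry sum \<open>n\<close> arises (\<open>bij_betw_type_matrix\<close>).

  The order reversal also fixes the sign: the positions that a diagonal entry counts are
  reversed by \<open>\<sigma>\<close>, so that they contribute half of the entry, rounded down, many transpositions,
  and a pair of equal off-diagonal entries contributes one transposition per unit
  (\<open>sign_eq_prod_edge_sign\<close>). The sign is thus a product over the \<open>(m + 2) choose 2\<close> independent
  entries on and above the diagonal. An off-diagonal entry has the generating function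
  \<open>1 - u\<^sup>2 + u\<^sup>4 - \<dots> = 1 / (1 + u\<^sup>2)\<close>, and each of the \<open>m + 1\<close> diagonal ones has
  \<open>1 + u - u\<^sup>2 - u\<^sup>3 + \<dots> = (1 + u) / (1 + u\<^sup>2)\<close>. Their product is the right-hand side
  (\<open>matrix_series_closed_form\<close>).
\<close>

section \<open>Labelings compatible with a permutation\<close>

definition labelings :: "nat \<Rightarrow> (nat \<Rightarrow> nat) \<Rightarrow> nat \<Rightarrow> (nat \<Rightarrow> nat) set" where
  "labelings n \<sigma> m =
     {a \<in> {1..n} \<rightarrow>\<^sub>E {..m}.
        \<forall>i\<in>{1..<n}. a i \<le> a (Suc i) \<and> (\<sigma> i < \<sigma> (Suc i) \<longrightarrow> a i < a (Suc i))}"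

lemma finite_labelings: "finite (labelings n \<sigma> m)"
  unfolding labelings_def by (rule finite_subset[OF Collect_subset]) (rule finite_PiE, auto)

lemma labelings_mono:
  assumes "a \<in> labelings n \<sigma> m" "1 \<le> i" "i \<le> j" "j \<le> n"
  shows "a i \<le> a j"
  using assms(3,4)
proof (induction j rule: dec_induct)
  case (step k)
  then have "a k \<le> a (Suc k)"
    using assms(1,2) by (auto simp: labelings_def)
  with step show ?case by simp
qed simp

text \<open>
  A run of equal labels contains no rise, so \<open>\<sigma>\<close> decreases along it.
\<close>

lemma labelings_eq_imp_decreasing:
  assumes "a \<in> labelings n \<sigma> m" "inj \<sigma>" "1 \<le> i" "i < j" "j \<le> n" "a i = a j"
  shows "\<sigma> j < \<sigma> i"
  using Suc_leI[OF assms(4)] assms(5,6)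
proof (induction j rule: dec_induct)
  case base
  have "\<not> \<sigma> i < \<sigma> (Suc i)"
    using assms(1,3) base by (auto simp: labelings_def)
  moreover have "\<sigma> i \<noteq> \<sigma> (Suc i)"
    using assms(2) by (simp add: inj_eq)
  ultimately show ?case by simp
next
  case (step k)
  have "a i \<le> a k" "a k \<le> a (Suc k)"
    using labelings_mono[OF assms(1), of i k] labelings_mono[OF assms(1), of k "Suc k"]
      assms(3) step.hyps step.prems(1) by simp_all
  then have eq: "a i = a k" "a k = a (Suc k)"
    using step by auto
  then have "\<not> \<sigma> k < \<sigma> (Suc k)"
    using assms(1,3) step by (auto simp: labelings_def)
  moreover have "\<sigma> k \<noteq> \<sigma> (Suc k)"
    using assms(2) by (simp add: inj_eq)
  ultimately show ?case
    using step eq by auto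
qed

text \<open>
  Position 0 lies outside the permuted set, so \<open>\<sigma> 0 < \<sigma> 1\<close> is not a rise.
\<close>

abbreviation rise_at :: "(nat \<Rightarrow> nat) \<Rightarrow> nat \<Rightarrow> bool" where
  "rise_at \<sigma> n \<equiv> 1 \<le> n \<and> \<sigma> n < \<sigma> (Suc n)"

text \<open>
  A labeling of length \<open>n + 1\<close> with the largest possible last label arises by appending that label
  to a labeling of length \<open>n\<close>. With \<open>labelings_bounded_last\<close> for the remaining labelings, this gives
  a recurrence in the length and the label bound.
\<close>

lemma labelings_last_eq:
  "{a \<in> labelings (Suc n) \<sigma> m. a (Suc n) = m} =
     (\<lambda>b. b(Suc n := m)) ` {b \<in> labelings n \<sigma> m. rise_at \<sigma> n \<longrightarrow> b n < m}"
proof (intro equalityI subsetI)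
  fix a assume a: "a \<in> {a \<in> labelings (Suc n) \<sigma> m. a (Suc n) = m}"
  define b where "b = a(Suc n := undefined)"
  have "b \<in> labelings n \<sigma> m"
    using a by (auto simp: labelings_def b_def PiE_def extensional_def)
  moreover have "b n < m" if "rise_at \<sigma> n"
    using a that by (auto simp: labelings_def b_def)
  moreover have "a = b(Suc n := m)"
    using a by (auto simp: b_def)
  ultimately show "a \<in> (\<lambda>b. b(Suc n := m)) ` {b \<in> labelings n \<sigma> m. rise_at \<sigma> n \<longrightarrow> b n < m}"
    by blast
next
  fix a assume "a \<in> (\<lambda>b. b(Suc n := m)) ` {b \<in> labelings n \<sigma> m. rise_at \<sigma> n \<longrightarrow> b n < m}"
  then obtain b where b: "b \<in> labelings n \<sigma> m" "rise_at \<sigma> n \<longrightarrow> b n < m" "a = b(Suc n := m)"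
    by blast
  have "a i \<le> a (Suc i) \<and> (\<sigma> i < \<sigma> (Suc i) \<longrightarrow> a i < a (Suc i))" if "i \<in> {1..<Suc n}" for i
    using b that by (cases "i = n") (auto simp: labelings_def PiE_def)
  moreover have "a \<in> {1..Suc n} \<rightarrow>\<^sub>E {..m}"
    using b by (auto simp: labelings_def PiE_def extensional_def)
  ultimately show "a \<in> {a \<in> labelings (Suc n) \<sigma> m. a (Suc n) = m}"
    using b(3) by (auto simp: labelings_def)
qed

lemma card_labelings_last_eq:
  "card {a \<in> labelings (Suc n) \<sigma> m. a (Suc n) = m} =
     card {b \<in> labelings n \<sigma> m. rise_at \<sigma> n \<longrightarrow> b n < m}"
  unfolding labelings_last_eq
proof (rule card_image, rule inj_onI)
  fix b c :: "nat \<Rightarrow> nat"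
  assume "b \<in> {b \<in> labelings n \<sigma> m. rise_at \<sigma> n \<longrightarrow> b n < m}"
    "c \<in> {b \<in> labelings n \<sigma> m. rise_at \<sigma> n \<longrightarrow> b n < m}"
    and eq: "b(Suc n := m) = c(Suc n := m)"
  then have ext: "b (Suc n) = undefined" "c (Suc n) = undefined"
    by (auto simp: labelings_def PiE_def extensional_def)
  show "b = c"
  proof
    fix k show "b k = c k"
      using fun_cong[OF eq, of k] ext by (cases "k = Suc n") auto
  qed
qed

lemma labelings_bounded_last:
  assumes "1 \<le> n"
  shows "{b \<in> labelings n \<sigma> (Suc m). b n < Suc m} = labelings n \<sigma> m"
proof (intro equalityI subsetI)
  fix b assume b: "b \<in> {b \<in> labelings n \<sigma> (Suc m). b n < Suc m}"
  then have "b k \<le> m" if "k \<in> {1..n}" for k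
    using labelings_mono[of b n \<sigma> "Suc m" k n] that by auto
  with b show "b \<in> labelings n \<sigma> m"
    by (auto simp: labelings_def PiE_def Pi_def)
next
  fix b assume "b \<in> labelings n \<sigma> m"
  with assms show "b \<in> {b \<in> labelings n \<sigma> (Suc m). b n < Suc m}"
    by (auto simp: labelings_def PiE_def Pi_def le_Suc_eq less_Suc_eq_le)
qed

lemma card_labelings_Suc_Suc:
  "card (labelings (Suc n) \<sigma> (Suc m)) =
     card (labelings (Suc n) \<sigma> m) + card (labelings n \<sigma> (if rise_at \<sigma> n then m else Suc m))"
proof -
  let ?L = "labelings (Suc n) \<sigma> (Suc m)"
  have "?L = {a \<in> ?L. a (Suc n) < Suc m} \<union> {a \<in> ?L. a (Suc n) = Suc m}"
    by (auto simp: labelings_def PiE_def Pi_def less_Suc_eq_le le_Suc_eq)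
  moreover have "card \<dots> = card {a \<in> ?L. a (Suc n) < Suc m} + card {a \<in> ?L. a (Suc n) = Suc m}"
    by (rule card_Un_disjoint) (auto simp: finite_labelings)
  moreover have "{b \<in> labelings n \<sigma> (Suc m). rise_at \<sigma> n \<longrightarrow> b n < Suc m} =
      labelings n \<sigma> (if rise_at \<sigma> n then m else Suc m)"
    using labelings_bounded_last[of n \<sigma> m] by (cases "rise_at \<sigma> n") auto
  ultimately show ?thesis
    using labelings_bounded_last[of "Suc n" \<sigma> m]
    by (simp add: card_labelings_last_eq)
qed

lemma card_labelings_Suc_0:
  "card (labelings (Suc n) \<sigma> 0) = (if rise_at \<sigma> n then 0 else card (labelings n \<sigma> 0))"
proof -
  have "labelings (Suc n) \<sigma> 0 = {a \<in> labelings (Suc n) \<sigma> 0. a (Suc n) = 0}"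
    by (auto simp: labelings_def PiE_def Pi_def)
  then have "card (labelings (Suc n) \<sigma> 0) =
      card {b \<in> labelings n \<sigma> 0. rise_at \<sigma> n \<longrightarrow> b n < 0}"
    by (metis card_labelings_last_eq)
  then show ?thesis by simp
qed

lemma ris_Suc: "ris (Suc n) \<sigma> = ris n \<sigma> + (if rise_at \<sigma> n then 1 else 0)"
proof -
  have "{i \<in> {1..<Suc n}. \<sigma> i < \<sigma> (i + 1)} =
      {i \<in> {1..<n}. \<sigma> i < \<sigma> (i + 1)} \<union> (if rise_at \<sigma> n then {n} else {})"
    by (auto simp: less_Suc_eq)
  then show ?thesis
    by (auto simp: ris_def card_insert_if)
qed

text \<open>
  Multiplication by \<open>1 - fps_X\<close> takes differences in the label bound. By the recurrence, the
  difference for length \<open>n + 1\<close> is the series for length \<open>n\<close>, delayed by one in the bound if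
  \<open>\<sigma>\<close> rises at \<open>n\<close>; so each new position costs one factor \<open>1 - fps_X\<close> and each rise
  contributes one factor \<open>fps_X\<close>.
\<close>

lemma labelings_generating_function:
  "(1 - fps_X) ^ Suc n * Abs_fps (\<lambda>m. of_nat (card (labelings n \<sigma> m))) = (fps_X ^ ris n \<sigma> :: rat fps)"
proof (induction n)
  case 0
  have "labelings 0 \<sigma> m = {\<lambda>_. undefined}" for m
    by (auto simp: labelings_def)
  moreover have "(1 - fps_X) * Abs_fps (\<lambda>_. 1) = (1 :: rat fps)"
    by (rule fps_ext) (simp add: left_diff_distrib)
  ultimately show ?case
    by (simp add: ris_def)
next
  case (Suc n)
  let ?G = "\<lambda>n. Abs_fps (\<lambda>m. of_nat (card (labelings n \<sigma> m))) :: rat fps"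
  have step: "(1 - fps_X) * ?G (Suc n) = fps_X ^ (if rise_at \<sigma> n then 1 else 0) * ?G n"
  proof (rule fps_ext)
    fix m show "((1 - fps_X) * ?G (Suc n)) $ m = (fps_X ^ (if rise_at \<sigma> n then 1 else 0) * ?G n) $ m"
      by (cases m) (auto simp: left_diff_distrib card_labelings_Suc_Suc card_labelings_Suc_0)
  qed
  have "(1 - fps_X) ^ Suc (Suc n) * ?G (Suc n) =
      (1 - fps_X) ^ Suc n * ((1 - fps_X) * ?G (Suc n))"
    by (simp add: mult_ac)
  also have "\<dots> = fps_X ^ (if rise_at \<sigma> n then 1 else 0) * ((1 - fps_X) ^ Suc n * ?G n)"
    by (simp only: step mult_ac)
  also have "\<dots> = fps_X ^ ris (Suc n) \<sigma>"
    by (simp only: Suc.IH ris_Suc power_add mult_ac)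
  finally show ?case .
qed

section \<open>Involutions and labelings as symmetric matrices\<close>

definition type_matrix :: "nat \<Rightarrow> (nat \<Rightarrow> nat) \<Rightarrow> (nat \<Rightarrow> nat) \<Rightarrow> nat \<Rightarrow> nat \<Rightarrow> nat" where
  "type_matrix n \<sigma> a i j = card {k \<in> {1..n}. a k = i \<and> a (\<sigma> k) = j}"

definition symmetric_matrices :: "nat \<Rightarrow> nat \<Rightarrow> (nat \<Rightarrow> nat \<Rightarrow> nat) set" where
  "symmetric_matrices m n =
     {N. (\<forall>i j. N i j = N j i) \<and> (\<forall>i j. m < i \<longrightarrow> N i j = 0) \<and> (\<Sum>i\<le>m. \<Sum>j\<le>m. N i j) = n}"

lemma symmetric_matricesD:
  assumes "N \<in> symmetric_matrices m n"
  shows "N i j = N j i" "\<not> (i \<le> m \<and> j \<le> m) \<Longrightarrow> N i j = 0" "(\<Sum>i\<le>m. \<Sum>j\<le>m. N i j) = n"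
proof -
  have N: "\<forall>i j. N i j = N j i" "\<forall>i j. m < i \<longrightarrow> N i j = 0" "(\<Sum>i\<le>m. \<Sum>j\<le>m. N i j) = n"
    using assms by (auto simp: symmetric_matrices_def)
  show sym: "N i j = N j i" for i j
    using N(1) by blast
  show "N i j = 0" if "\<not> (i \<le> m \<and> j \<le> m)"
    using that N(2) sym[of i j] by (cases "i \<le> m") auto
  show "(\<Sum>i\<le>m. \<Sum>j\<le>m. N i j) = n" by (fact N(3))
qed

text \<open>
  The cells of a matrix are its entries unfolded into units: \<open>(i, m - j, r)\<close> is unit number \<open>r\<close> of
  the entry at \<open>(i, j)\<close>. The column is stored as \<open>m - j\<close> so that the lexicographic order on triples
  lists each row by decreasing columns, as the positions with label \<open>i\<close> are sorted by the label of
  their image.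
\<close>

definition cells :: "nat \<Rightarrow> (nat \<Rightarrow> nat \<Rightarrow> nat) \<Rightarrow> (nat \<times> nat \<times> nat) set" where
  "cells m N = {(i, j, r). i \<le> m \<and> j \<le> m \<and> r < N i (m - j)}"

text \<open>
  The involution that a symmetric matrix induces on its cells. It transposes the entry and reverses
  the order of its units.
\<close>

definition flip :: "nat \<Rightarrow> (nat \<Rightarrow> nat \<Rightarrow> nat) \<Rightarrow> nat \<times> nat \<times> nat \<Rightarrow> nat \<times> nat \<times> nat" where
  "flip m N = (\<lambda>(i, j, r). (m - j, m - i, N i (m - j) - 1 - r))"

lemma cells_eq_Sigma: "cells m N = (SIGMA i:{..m}. SIGMA j:{..m}. {..<N i (m - j)})"
  by (auto simp: cells_def)

lemma finite_cells: "finite (cells m N)"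
  unfolding cells_eq_Sigma by simp

lemma card_cells: "card (cells m N) = (\<Sum>i\<le>m. \<Sum>j\<le>m. N i j)"
proof -
  have "(\<Sum>j\<le>m. N i (m - j)) = (\<Sum>j\<le>m. N i j)" for i
    by (rule sum.reindex_bij_witness[of _ "\<lambda>j. m - j" "\<lambda>j. m - j"]) auto
  then show ?thesis
    unfolding cells_eq_Sigma by simp
qed

lemma flip_in_cells:
  assumes "\<And>i j. N i j = N j i" "p \<in> cells m N"
  shows "flip m N p \<in> cells m N"
proof -
  obtain i j r where p: "p = (i, j, r)" by (cases p)
  then have ijr: "i \<le> m" "j \<le> m" "r < N i (m - j)"
    using assms(2) by (auto simp: cells_def)
  then show ?thesis
    using assms(1)[of "m - j" i] by (simp add: p flip_def cells_def)
qed

lemma flip_flip: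
  assumes "\<And>i j. N i j = N j i" "p \<in> cells m N"
  shows "flip m N (flip m N p) = p"
proof -
  obtain i j r where p: "p = (i, j, r)" by (cases p)
  then have ijr: "i \<le> m" "j \<le> m" "r < N i (m - j)"
    using assms(2) by (auto simp: cells_def)
  then show ?thesis
    using assms(1)[of "m - j" i] by (simp add: p flip_def)
qed

text \<open>
  Reversing the units of an entry fixes only the middle unit of a diagonal entry, which exists if
  the entry is odd.
\<close>

lemma card_flip_fixed:
  "card {p \<in> cells m N. flip m N p = p} = card {i \<in> {..m}. odd (N i i)}"
proof -
  have "{p \<in> cells m N. flip m N p = p} = (\<lambda>i. (i, m - i, N i i div 2)) ` {i \<in> {..m}. odd (N i i)}"
  proof (intro equalityI subsetI)
    fix p assume p: "p \<in> {p \<in> cells m N. flip m N p = p}"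
    obtain i j r where ijr: "p = (i, j, r)" by (cases p)
    from p have *: "i \<le> m" "j = m - i" "r < N i i" "N i i - 1 - r = r"
      by (auto simp: cells_def flip_def ijr)
    then have "N i i = 2 * r + 1" by simp
    with * show "p \<in> (\<lambda>i. (i, m - i, N i i div 2)) ` {i \<in> {..m}. odd (N i i)}"
      by (auto simp: ijr intro!: image_eqI[of _ _ i])
  next
    fix p assume "p \<in> (\<lambda>i. (i, m - i, N i i div 2)) ` {i \<in> {..m}. odd (N i i)}"
    then obtain i where i: "p = (i, m - i, N i i div 2)" "i \<le> m" "odd (N i i)"
      by auto
    then obtain r where "N i i = 2 * r + 1" by (auto elim: oddE)
    with i show "p \<in> {p \<in> cells m N. flip m N p = p}"
      by (auto simp: cells_def flip_def)
  qed
  moreover have "inj_on (\<lambda>i. (i, m - i, N i i div 2)) {i \<in> {..m}. odd (N i i)}"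
    by (rule inj_onI) simp
  ultimately show ?thesis
    by (simp add: card_image)
qed

lemma involutionsD:
  assumes "\<sigma> \<in> involutions n"
  shows "\<sigma> permutes {1..n}" "\<sigma> (\<sigma> k) = k" "k \<in> {1..n} \<Longrightarrow> \<sigma> k \<in> {1..n}" "inj \<sigma>"
proof -
  show *: "\<sigma> permutes {1..n}"
    using assms by (simp add: involutions_def)
  show "\<sigma> (\<sigma> k) = k"
    using assms by (simp add: involutions_def fun_eq_iff)
  show "\<sigma> k \<in> {1..n}" if "k \<in> {1..n}"
    using permutes_in_image[OF *] that by simp
  show "inj \<sigma>"
    using * by (rule permutes_inj)
qed

lemma type_matrix_symmetric:
  assumes "\<sigma> \<in> involutions n"
  shows "type_matrix n \<sigma> a i j = type_matrix n \<sigma> a j i"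
  unfolding type_matrix_def
  by (rule bij_betw_same_card[OF bij_betw_byWitness[where f = \<sigma> and f' = \<sigma>]])
    (use involutionsD[OF assms] in auto)

lemma labelings_bound: "a \<in> labelings n \<sigma> m \<Longrightarrow> k \<in> {1..n} \<Longrightarrow> a k \<le> m"
  by (auto simp: labelings_def PiE_def Pi_def)

lemma type_matrix_in_symmetric_matrices:
  assumes \<sigma>: "\<sigma> \<in> involutions n" and a: "a \<in> labelings n \<sigma> m"
  shows "type_matrix n \<sigma> a \<in> symmetric_matrices m n"
proof -
  have "(\<Sum>i\<le>m. \<Sum>j\<le>m. type_matrix n \<sigma> a i j) =
      (\<Sum>p\<in>{..m} \<times> {..m}. \<Sum>k | k \<in> {1..n} \<and> (a k, a (\<sigma> k)) = p. 1)"
    unfolding sum.cartesian_product by (rule sum.cong) (auto simp: type_matrix_def)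
  also have "\<dots> = (\<Sum>k\<in>{1..n}. 1)"
    by (rule sum.group) (use labelings_bound[OF a] involutionsD[OF \<sigma>] in auto)
  finally have "(\<Sum>i\<le>m. \<Sum>j\<le>m. type_matrix n \<sigma> a i j) = n"
    by simp
  moreover have "type_matrix n \<sigma> a i j = 0" if "m < i" for i j
    using labelings_bound[OF a] that by (fastforce simp: type_matrix_def)
  ultimately show ?thesis
    using type_matrix_symmetric[OF \<sigma>] by (auto simp: symmetric_matrices_def)
qed

text \<open>
  Sends a position to a cell of the type matrix. Positions of the same type are numbered from left
  to right. For an involution and a labeling of it, this is an order isomorphism under which \<open>\<sigma>\<close> becomes \<open>flip\<close>.
\<close>

definition cell_of :: "nat \<Rightarrow> (nat \<Rightarrow> nat) \<Rightarrow> nat \<Rightarrow> (nat \<Rightarrow> nat) \<Rightarrow> nat \<Rightarrow> nat \<times> nat \<times> nat" where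
  "cell_of n \<sigma> m a k =
     (a k, m - a (\<sigma> k), card {l \<in> {1..n}. l < k \<and> a l = a k \<and> a (\<sigma> l) = a (\<sigma> k)})"

lemma cell_of_strict_mono:
  assumes \<sigma>: "\<sigma> \<in> involutions n" and a: "a \<in> labelings n \<sigma> m"
  shows "strict_mono_on {1..n} (cell_of n \<sigma> m a)"
proof (rule strict_mono_onI)
  fix k l assume kl: "k \<in> {1..n}" "l \<in> {1..n}" "k < l"
  have le: "a k \<le> a l"
    using labelings_mono[OF a] kl by auto
  show "cell_of n \<sigma> m a k < cell_of n \<sigma> m a l"
  proof (cases "a k = a l")
    case True
    then have "\<sigma> l < \<sigma> k"
      using labelings_eq_imp_decreasing[OF a] involutionsD[OF \<sigma>] kl by auto
    then have le': "a (\<sigma> l) \<le> a (\<sigma> k)"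
      using labelings_mono[OF a, of "\<sigma> l" "\<sigma> k"] involutionsD(3)[OF \<sigma>] kl by auto
    have bd: "a (\<sigma> k) \<le> m" "a (\<sigma> l) \<le> m"
      using labelings_bound[OF a] involutionsD(3)[OF \<sigma>] kl by auto
    show ?thesis
    proof (cases "a (\<sigma> l) = a (\<sigma> k)")
      case eq: True
      have "card {x \<in> {1..n}. x < k \<and> a x = a k \<and> a (\<sigma> x) = a (\<sigma> k)}
          < card {x \<in> {1..n}. x < l \<and> a x = a l \<and> a (\<sigma> x) = a (\<sigma> l)}"
      proof (rule psubset_card_mono)
        have "k \<in> {x \<in> {1..n}. x < l \<and> a x = a l \<and> a (\<sigma> x) = a (\<sigma> l)}"
          using kl True eq by simp
        then show "{x \<in> {1..n}. x < k \<and> a x = a k \<and> a (\<sigma> x) = a (\<sigma> k)}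
            \<subset> {x \<in> {1..n}. x < l \<and> a x = a l \<and> a (\<sigma> x) = a (\<sigma> l)}"
          using kl(3) unfolding True[symmetric] eq by fastforce
      qed simp
      then show ?thesis
        using True eq by (simp add: cell_of_def)
    next
      case False
      then show ?thesis
        using True le' bd by (auto simp: cell_of_def)
    qed
  qed (use le in \<open>auto simp: cell_of_def\<close>)
qed

text \<open>
  The map is injective by monotonicity and there are as many cells as positions, so it suffices that
  its values are cells.
\<close>

lemma bij_betw_cell_of:
  assumes \<sigma>: "\<sigma> \<in> involutions n" and a: "a \<in> labelings n \<sigma> m"
  shows "bij_betw (cell_of n \<sigma> m a) {1..n} (cells m (type_matrix n \<sigma> a))"
proof -
  let ?C = "cells m (type_matrix n \<sigma> a)"
  have inj: "inj_on (cell_of n \<sigma> m a) {1..n}"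
    using cell_of_strict_mono[OF assms] by (rule strict_mono_on_imp_inj_on)
  have "cell_of n \<sigma> m a ` {1..n} \<subseteq> ?C"
  proof (rule image_subsetI)
    fix k assume k: "k \<in> {1..n}"
    have "card {l \<in> {1..n}. l < k \<and> a l = a k \<and> a (\<sigma> l) = a (\<sigma> k)}
        < card {l \<in> {1..n}. a l = a k \<and> a (\<sigma> l) = a (\<sigma> k)}"
      by (rule psubset_card_mono) (use k in \<open>simp, blast\<close>)
    then show "cell_of n \<sigma> m a k \<in> ?C"
      using labelings_bound[OF a] involutionsD(3)[OF \<sigma>] k
      by (auto simp: cell_of_def cells_def type_matrix_def)
  qed
  moreover have "card ?C = n"
    using type_matrix_in_symmetric_matrices[OF assms] by (simp add: card_cells symmetric_matrices_def)
  ultimately have "cell_of n \<sigma> m a ` {1..n} = ?C"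
    using inj by (intro card_subset_eq) (auto simp: finite_cells card_image)
  with inj show ?thesis by (simp add: bij_betw_def)
qed

text \<open>
  Among the positions of the same type as \<open>k\<close>, the involution reverses the order. So the positions
  before \<open>\<sigma> k\<close> of its type are the images of those after \<open>k\<close>, which turns the unit number \<open>r\<close> of
  \<open>k\<close> into \<open>N i j - 1 - r\<close>.
\<close>

lemma cell_of_involution:
  assumes \<sigma>: "\<sigma> \<in> involutions n" and a: "a \<in> labelings n \<sigma> m" and k: "k \<in> {1..n}"
  shows "cell_of n \<sigma> m a (\<sigma> k) = flip m (type_matrix n \<sigma> a) (cell_of n \<sigma> m a k)"
proof -
  let ?T = "{l \<in> {1..n}. a l = a k \<and> a (\<sigma> l) = a (\<sigma> k)}"
  note \<sigma>D = involutionsD[OF \<sigma>]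
  have swap: "\<sigma> l < \<sigma> k \<longleftrightarrow> k < l" if "l \<in> ?T" for l
    using labelings_eq_imp_decreasing[OF a \<sigma>D(4), of k l] labelings_eq_imp_decreasing[OF a \<sigma>D(4), of l k] that k
    by (cases l k rule: linorder_cases) auto
  \<comment> \<open>Both numberings exclude the position itself, which accounts for the \<open>- 1\<close> in \<open>flip\<close>.\<close>
  have "bij_betw \<sigma> {l \<in> ?T. k < l} {l \<in> {1..n}. l < \<sigma> k \<and> a l = a (\<sigma> k) \<and> a (\<sigma> l) = a (\<sigma> (\<sigma> k))}"
  proof (rule bij_betw_byWitness[where f' = \<sigma>])
    show "\<sigma> ` {l \<in> ?T. k < l} \<subseteq> {l \<in> {1..n}. l < \<sigma> k \<and> a l = a (\<sigma> k) \<and> a (\<sigma> l) = a (\<sigma> (\<sigma> k))}"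
      using swap \<sigma>D(2,3) by auto
    show "\<sigma> ` {l \<in> {1..n}. l < \<sigma> k \<and> a l = a (\<sigma> k) \<and> a (\<sigma> l) = a (\<sigma> (\<sigma> k))} \<subseteq> {l \<in> ?T. k < l}"
    proof (rule image_subsetI)
      fix l assume l: "l \<in> {l \<in> {1..n}. l < \<sigma> k \<and> a l = a (\<sigma> k) \<and> a (\<sigma> l) = a (\<sigma> (\<sigma> k))}"
      then have "\<sigma> l \<in> ?T"
        using \<sigma>D(3)[of l] by (simp add: \<sigma>D(2))
      with swap[of "\<sigma> l"] l show "\<sigma> l \<in> {l \<in> ?T. k < l}"
        by (simp add: \<sigma>D(2))
    qed
  qed (simp_all add: \<sigma>D(2))
  from bij_betw_same_card[OF this]
  have later: "card {l \<in> {1..n}. l < \<sigma> k \<and> a l = a (\<sigma> k) \<and> a (\<sigma> l) = a (\<sigma> (\<sigma> k))}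
      = card {l \<in> ?T. k < l}" by simp
  have "?T = insert k ({l \<in> ?T. l < k} \<union> {l \<in> ?T. k < l})"
    using k by auto
  then have "card ?T = card (insert k ({l \<in> ?T. l < k} \<union> {l \<in> ?T. k < l}))"
    by (rule arg_cong)
  also have "\<dots> = Suc (card ({l \<in> ?T. l < k} \<union> {l \<in> ?T. k < l}))"
    by (rule card_insert_disjoint) auto
  also have "card ({l \<in> ?T. l < k} \<union> {l \<in> ?T. k < l}) = card {l \<in> ?T. l < k} + card {l \<in> ?T. k < l}"
    by (rule card_Un_disjoint) auto
  finally have "card {l \<in> ?T. k < l} = card ?T - 1 - card {l \<in> ?T. l < k}"
    by simp
  moreover have "{l \<in> ?T. l < k} = {l \<in> {1..n}. l < k \<and> a l = a k \<and> a (\<sigma> l) = a (\<sigma> k)}"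
    by auto
  ultimately show ?thesis
    using later labelings_bound[OF a] \<sigma>D(3) k
    by (simp add: cell_of_def flip_def type_matrix_def \<sigma>D(2))
qed

section \<open>The matrix determines the pair, and every matrix occurs\<close>

text \<open>
  At the first disagreement, the smaller of the two values could not be attained by the other
  function at all.
\<close>

lemma strict_mono_enumeration_unique:
  fixes f g :: "nat \<Rightarrow> 'a::linorder"
  assumes f: "strict_mono_on {1..n} f" and g: "strict_mono_on {1..n} g"
    and img: "f ` {1..n} = g ` {1..n}" and k: "k \<in> {1..n}"
  shows "f k = g k"
proof -
  have aux: "\<not> f k < g k"
    if f: "strict_mono_on {1..n} f" and g: "strict_mono_on {1..n} g"
      and img: "f ` {1..n} = g ` {1..n}" and k: "k \<in> {1..n}"
      and agree: "\<And>j. j \<in> {1..n} \<Longrightarrow> j < k \<Longrightarrow> f j = g j"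
    for f g :: "nat \<Rightarrow> 'a" and k
  proof
    assume less: "f k < g k"
    obtain j where j: "j \<in> {1..n}" "f k = g j"
      using img k by blast
    show False
    proof (cases "j < k")
      case True
      then have "f k = f j" using agree j by simp
      moreover have "f j < f k" using strict_mono_onD[OF f j(1) k True] .
      ultimately show False by simp
    next
      case False
      then have "g k \<le> g j"
        using strict_mono_onD[OF g k j(1)] by (cases "j = k") auto
      with less j show False by simp
    qed
  qed
  show ?thesis
    using k
  proof (induction k rule: less_induct)
    case (less k)
    then show ?case
      using aux[OF f g img, of k] aux[OF g f img[symmetric], of k] by fastforce
  qed
qed

text \<open>
  Counterpart of \<open>labelings_eq_imp_decreasing\<close>: it ensures that the row index is a labeling of the
  involution that \<open>flip\<close> induces on positions.
\<close>

lemma flip_decreasing: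
  assumes "p \<in> cells m N" "q \<in> cells m N" "fst p = fst q" "p < q"
  shows "flip m N q < flip m N p"
proof -
  obtain x j r j' r' where pq: "p = (x, j, r)" "q = (x, j', r')"
    using assms(3) by (cases p, cases q) auto
  with assms have b: "j \<le> m" "j' \<le> m" "r < N x (m - j)" "r' < N x (m - j')"
    and less: "j < j' \<or> j = j' \<and> r < r'"
    by (auto simp: cells_def)
  from less show ?thesis
  proof
    assume "j < j'"
    with b have "m - j' < m - j" by linarith
    then show ?thesis by (simp add: pq flip_def)
  next
    assume "j = j' \<and> r < r'"
    with b show ?thesis by (auto simp: pq flip_def)
  qed
qed

text \<open>
  The cells have only one increasing enumeration, so \<open>cell_of\<close> depends on the matrix alone. Its
  first component is \<open>a\<close>, and \<open>\<sigma>\<close> is \<open>flip\<close> transported along it.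
\<close>

lemma type_matrix_inj:
  assumes \<sigma>: "\<sigma> \<in> involutions n" and a: "a \<in> labelings n \<sigma> m"
    and \<rho>: "\<rho> \<in> involutions n" and b: "b \<in> labelings n \<rho> m"
    and eq: "type_matrix n \<sigma> a = type_matrix n \<rho> b"
  shows "\<sigma> = \<rho> \<and> a = b"
proof -
  let ?e = "cell_of n \<sigma> m a" and ?f = "cell_of n \<rho> m b"
  note bij = bij_betw_cell_of[OF \<sigma> a] bij_betw_cell_of[OF \<rho> b]
  have same: "?e k = ?f k" if "k \<in> {1..n}" for k
    using cell_of_strict_mono[OF \<sigma> a] cell_of_strict_mono[OF \<rho> b] _ that
  proof (rule strict_mono_enumeration_unique)
    show "?e ` {1..n} = ?f ` {1..n}"
      using bij eq by (simp add: bij_betw_def)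
  qed
  have "a k = b k" if "k \<in> {1..n}" for k
    using same[OF that] by (simp add: cell_of_def)
  moreover have "a \<in> extensional {1..n}" "b \<in> extensional {1..n}"
    using a b by (auto simp: labelings_def PiE_def)
  ultimately have "a = b"
    using extensionalityI by blast
  moreover have "\<sigma> k = \<rho> k" for k
  proof (cases "k \<in> {1..n}")
    case True
    have "?e (\<sigma> k) = ?f (\<rho> k)"
      using cell_of_involution[OF \<sigma> a True] cell_of_involution[OF \<rho> b True] same[OF True] eq
      by simp
    also have "\<dots> = ?e (\<rho> k)"
      using same[OF involutionsD(3)[OF \<rho> True]] by simp
    finally show ?thesis
      using bij(1) involutionsD(3)[OF \<sigma> True] involutionsD(3)[OF \<rho> True]
      by (meson bij_betw_def inj_onD)
  next
    case False
    then show ?thesis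
      using involutionsD(1)[OF \<sigma>] involutionsD(1)[OF \<rho>] by (simp add: permutes_not_in)
  qed
  ultimately show ?thesis by auto
qed

lemma cells_enumeration:
  assumes "card (cells m N) = n"
  obtains e where "strict_mono_on {1..n} e" "bij_betw e {1..n} (cells m N)"
proof -
  obtain h where h: "bij_betw h {..<n} (cells m N)" "strict_mono_on {..<n} h"
    using ex_bij_betw_strict_mono_card[OF finite_cells[of m N]] assms by auto
  \<comment> \<open>The enumeration \<open>h\<close> starts at 0, but positions start at 1.\<close>
  have "bij_betw (\<lambda>k. k - 1) {1..n} {..<n}"
    by (rule bij_betw_byWitness[where f' = Suc]) auto
  from bij_betw_trans[OF this h(1)] have "bij_betw (h \<circ> (\<lambda>k. k - 1)) {1..n} (cells m N)" .
  moreover have "strict_mono_on {1..n} (h \<circ> (\<lambda>k. k - 1))"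
    by (rule strict_mono_onI) (auto intro!: strict_mono_onD[OF h(2)])
  ultimately show ?thesis using that by blast
qed

text \<open>
  The pair is read off from the increasing enumeration \<open>e\<close> of the cells: \<open>\<sigma>\<close> is \<open>flip\<close> transported
  along \<open>e\<close>, and the label of a position is the row of its cell.
\<close>

lemma type_matrix_surj:
  assumes N: "N \<in> symmetric_matrices m n"
  obtains \<sigma> a where "\<sigma> \<in> involutions n" "a \<in> labelings n \<sigma> m" "type_matrix n \<sigma> a = N"
proof -
  note sym = symmetric_matricesD(1)[OF N]
  have "card (cells m N) = n"
    using symmetric_matricesD(3)[OF N] by (simp add: card_cells)
  then obtain e where mono: "strict_mono_on {1..n} e" and bij: "bij_betw e {1..n} (cells m N)"
    by (rule cells_enumeration)
  have e_in: "e k \<in> cells m N" if "k \<in> {1..n}" for k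
    using bij that by (rule bij_betwE[THEN bspec])
  have e_inj: "k = l" if "e k = e l" "k \<in> {1..n}" "l \<in> {1..n}" for k l
    using bij that by (meson bij_betw_def inj_onD)
  define \<sigma> where "\<sigma> k = (if k \<in> {1..n} then inv_into {1..n} e (flip m N (e k)) else k)" for k
  define a where "a k = (if k \<in> {1..n} then fst (e k) else undefined)" for k
  have flip_img: "flip m N (e k) \<in> e ` {1..n}" if "k \<in> {1..n}" for k
    using flip_in_cells[OF sym e_in[OF that]] bij by (simp add: bij_betw_def)
  have \<sigma>_in: "\<sigma> k \<in> {1..n}" if "k \<in> {1..n}" for k
    using inv_into_into[OF flip_img[OF that]] that by (simp add: \<sigma>_def)
  have e_\<sigma>: "e (\<sigma> k) = flip m N (e k)" if "k \<in> {1..n}" for k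
    using f_inv_into_f[OF flip_img[OF that]] that by (simp add: \<sigma>_def)
  have \<sigma>_out: "\<sigma> k = k" if "k \<notin> {1..n}" for k
    using that by (auto simp: \<sigma>_def)
  have \<sigma>\<sigma>: "\<sigma> (\<sigma> k) = k" for k
  proof (cases "k \<in> {1..n}")
    case True
    then have "e (\<sigma> (\<sigma> k)) = e k"
      using e_\<sigma> \<sigma>_in flip_flip[OF sym e_in] by metis
    then show ?thesis
      using e_inj \<sigma>_in True by metis
  qed (simp add: \<sigma>_out)
  have "bij_betw \<sigma> {1..n} {1..n}"
    by (rule bij_betw_byWitness[where f' = \<sigma>]) (use \<sigma>_in \<sigma>\<sigma> in blast)+
  then have "\<sigma> permutes {1..n}"
    using \<sigma>_out by (rule bij_imp_permutes)
  with \<sigma>\<sigma> have \<sigma>: "\<sigma> \<in> involutions n"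
    by (simp add: involutions_def fun_eq_iff)
  have a: "a \<in> labelings n \<sigma> m"
    unfolding labelings_def
  proof (intro CollectI conjI ballI)
    show "a \<in> {1..n} \<rightarrow>\<^sub>E {..m}"
    proof (rule PiE_I)
      fix k assume k: "k \<in> {1..n}"
      show "a k \<in> {..m}"
        using e_in[OF k] k by (auto simp: a_def cells_def)
    qed (auto simp: a_def)
    fix i assume "i \<in> {1..<n}"
    then have i: "i \<in> {1..n}" "Suc i \<in> {1..n}" by auto
    have less: "e i < e (Suc i)"
      using strict_mono_onD[OF mono i] by simp
    then have le: "fst (e i) \<le> fst (e (Suc i))"
      by (cases "e i"; cases "e (Suc i)") auto
    then show "a i \<le> a (Suc i)"
      using i by (simp add: a_def)
    show "\<sigma> i < \<sigma> (Suc i) \<longrightarrow> a i < a (Suc i)"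
    proof (rule impI, rule ccontr)
      assume rise: "\<sigma> i < \<sigma> (Suc i)" and "\<not> a i < a (Suc i)"
      then have "fst (e i) = fst (e (Suc i))"
        using le i by (simp add: a_def)
      then have "e (\<sigma> (Suc i)) < e (\<sigma> i)"
        using flip_decreasing[OF e_in e_in _ less] i e_\<sigma> by simp
      moreover have "e (\<sigma> i) < e (\<sigma> (Suc i))"
        using strict_mono_onD[OF mono _ _ rise] \<sigma>_in i by blast
      ultimately show False by simp
    qed
  qed
  have "type_matrix n \<sigma> a i j = N i j" for i j
  proof (cases "i \<le> m \<and> j \<le> m")
    case True
    have "bij_betw e {k \<in> {1..n}. a k = i \<and> a (\<sigma> k) = j}
        {p \<in> cells m N. fst p = i \<and> fst (flip m N p) = j}"
    proof (rule bij_betw_imageI)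
      show "inj_on e {k \<in> {1..n}. a k = i \<and> a (\<sigma> k) = j}"
        by (rule inj_on_subset[OF bij_betw_imp_inj_on[OF bij]]) blast
      show "e ` {k \<in> {1..n}. a k = i \<and> a (\<sigma> k) = j} =
          {p \<in> cells m N. fst p = i \<and> fst (flip m N p) = j}"
      proof (intro equalityI subsetI)
        fix p assume "p \<in> e ` {k \<in> {1..n}. a k = i \<and> a (\<sigma> k) = j}"
        then obtain k where k: "p = e k" "k \<in> {1..n}" "a k = i" "a (\<sigma> k) = j" by auto
        then show "p \<in> {p \<in> cells m N. fst p = i \<and> fst (flip m N p) = j}"
          using e_in[OF k(2)] e_\<sigma>[OF k(2)] \<sigma>_in[OF k(2)] by (simp add: a_def)
      next
        fix p assume p: "p \<in> {p \<in> cells m N. fst p = i \<and> fst (flip m N p) = j}"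
        then obtain k where k: "p = e k" "k \<in> {1..n}"
          using bij unfolding bij_betw_def by blast
        then have "a k = i" "a (\<sigma> k) = j"
          using p e_\<sigma>[OF k(2)] \<sigma>_in[OF k(2)] by (simp_all add: a_def)
        with k show "p \<in> e ` {k \<in> {1..n}. a k = i \<and> a (\<sigma> k) = j}" by blast
      qed
    qed
    then have "type_matrix n \<sigma> a i j = card {p \<in> cells m N. fst p = i \<and> fst (flip m N p) = j}"
      unfolding type_matrix_def by (rule bij_betw_same_card)
    also have "{p \<in> cells m N. fst p = i \<and> fst (flip m N p) = j} = (\<lambda>r. (i, m - j, r)) ` {..<N i j}"
      using True by (auto simp: cells_def flip_def)
    also have "card \<dots> = N i j"
      by (subst card_image) (auto intro: inj_onI)
    finally show ?thesis .
  next
    case False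
    then show ?thesis
      using symmetric_matricesD(2)[OF type_matrix_in_symmetric_matrices[OF \<sigma> a]]
        symmetric_matricesD(2)[OF N] by simp
  qed
  then have "type_matrix n \<sigma> a = N"
    by (intro ext)
  with \<sigma> a that show ?thesis by blast
qed

lemma bij_betw_type_matrix:
  "bij_betw (\<lambda>(\<sigma>, a). type_matrix n \<sigma> a) (SIGMA \<sigma>:involutions n. labelings n \<sigma> m)
     (symmetric_matrices m n)"
proof (rule bij_betw_imageI)
  show "inj_on (\<lambda>(\<sigma>, a). type_matrix n \<sigma> a) (SIGMA \<sigma>:involutions n. labelings n \<sigma> m)"
    by (rule inj_onI) (use type_matrix_inj in fastforce)
  show "(\<lambda>(\<sigma>, a). type_matrix n \<sigma> a) ` (SIGMA \<sigma>:involutions n. labelings n \<sigma> m) =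
      symmetric_matrices m n"
  proof (intro equalityI subsetI)
    fix N assume "N \<in> symmetric_matrices m n"
    then obtain \<sigma> a where "\<sigma> \<in> involutions n" "a \<in> labelings n \<sigma> m" "type_matrix n \<sigma> a = N"
      by (rule type_matrix_surj)
    then show "N \<in> (\<lambda>(\<sigma>, a). type_matrix n \<sigma> a) ` (SIGMA \<sigma>:involutions n. labelings n \<sigma> m)"
      by (intro image_eqI[of _ _ "(\<sigma>, a)"]) auto
  qed (use type_matrix_in_symmetric_matrices in auto)
qed

section \<open>The sign as a product over matrix entries\<close>

text \<open>
  Composing with the transposition of \<open>x\<close> and \<open>\<sigma> x\<close> removes one 2-cycle and changes the sign.
\<close>

lemma sign_involution:
  assumes "permutation \<sigma>" "\<sigma> \<circ> \<sigma> = id"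
  shows "sign \<sigma> = (-1) ^ (card {x. \<sigma> x \<noteq> x} div 2)"
  using assms
proof (induction "card {x. \<sigma> x \<noteq> x}" arbitrary: \<sigma> rule: less_induct)
  case less
  have fin: "finite {x. \<sigma> x \<noteq> x}"
    using less.prems(1) by (rule permutation_finite_support)
  have inv: "\<sigma> (\<sigma> x) = x" for x
    using less.prems(2) by (simp add: fun_eq_iff)
  show ?case
  proof (cases "\<exists>x. \<sigma> x \<noteq> x")
    case False
    then have "\<sigma> = id" by auto
    then show ?thesis by simp
  next
    case True
    then obtain x where x: "\<sigma> x \<noteq> x" by blast
    define y where "y = \<sigma> x"
    define \<rho> where "\<rho> = transpose x y \<circ> \<sigma>"
    have y: "\<sigma> y = x" "\<sigma> x = y" "y \<noteq> x"
      using inv x by (simp_all add: y_def)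
    have \<rho>: "\<rho> z = (if z = x \<or> z = y then z else \<sigma> z)" for z
      using y inv by (auto simp: \<rho>_def transpose_def) metis+
    have supp: "{z. \<sigma> z \<noteq> z} = insert x (insert y {z. \<rho> z \<noteq> z})"
      using y by (auto simp: \<rho>)
    moreover have "x \<notin> {z. \<rho> z \<noteq> z}" "y \<notin> {z. \<rho> z \<noteq> z}" by (auto simp: \<rho>)
    moreover have "finite {z. \<rho> z \<noteq> z}"
      using fin supp by simp
    ultimately have card: "card {z. \<sigma> z \<noteq> z} = card {z. \<rho> z \<noteq> z} + 2"
      using y by simp
    have perm: "permutation \<rho>"
      unfolding \<rho>_def by (intro permutation_compose permutation_swap_id less.prems)
    moreover have "\<rho> (\<rho> z) = z" for z
      using inv y by (auto simp: \<rho>) metis+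
    ultimately have "sign \<rho> = (-1) ^ (card {z. \<rho> z \<noteq> z} div 2)"
      using card by (intro less.hyps) (auto simp: fun_eq_iff)
    moreover have "\<sigma> = transpose x y \<circ> \<rho>"
      by (simp add: \<rho>_def fun_eq_iff)
    ultimately show ?thesis
      using perm y card by (simp add: sign_compose permutation_swap_id sign_swap_id)
  qed
qed

text \<open>
  The entries on and above the diagonal, which determine a symmetric matrix.
\<close>

definition edges :: "nat \<Rightarrow> (nat \<times> nat) set" where
  "edges m = {(i, j). i \<le> j \<and> j \<le> m}"

text \<open>
  The sign of the 2-cycles contributed by the entry \<open>k\<close> at \<open>e\<close> together with its mirror image: a
  diagonal entry gives \<open>k div 2\<close> of them and an off-diagonal one gives \<open>k\<close>.
\<close>

definition edge_sign :: "nat \<times> nat \<Rightarrow> nat \<Rightarrow> int" where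
  "edge_sign e k = (-1) ^ (if fst e = snd e then k div 2 else k)"

lemma finite_edges: "finite (edges m)"
  by (rule finite_subset[of _ "{..m} \<times> {..m}"]) (auto simp: edges_def)

lemma sum_symmetric_matrix:
  fixes N :: "nat \<Rightarrow> nat \<Rightarrow> nat"
  assumes sym: "\<And>i j. N i j = N j i"
  shows "(\<Sum>i\<le>m. \<Sum>j\<le>m. N i j) = (\<Sum>e\<in>edges m. (if fst e = snd e then 1 else 2) * case_prod N e)"
proof -
  let ?below = "{(i, j). j < i \<and> i \<le> m}" and ?above = "{(i, j). i < j \<and> j \<le> m}"
  have fin: "finite ?below" "finite ?above"
    by (rule finite_subset[of _ "{..m} \<times> {..m}"]; auto)+
  have "(\<Sum>i\<le>m. \<Sum>j\<le>m. N i j) = sum (case_prod N) ({..m} \<times> {..m})"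
    by (simp add: sum.cartesian_product)
  also have "{..m} \<times> {..m} = edges m \<union> ?below"
    by (auto simp: edges_def)
  also have "sum (case_prod N) \<dots> = sum (case_prod N) (edges m) + sum (case_prod N) ?below"
    by (rule sum.union_disjoint) (auto simp: finite_edges fin, auto simp: edges_def)
  also have "sum (case_prod N) ?below = sum (case_prod N) ?above"
    by (rule sum.reindex_bij_witness[of _ prod.swap prod.swap]) (auto simp: sym)
  also have "\<dots> = (\<Sum>e\<in>edges m. if fst e = snd e then 0 else case_prod N e)"
    by (rule sum.mono_neutral_cong_left) (auto simp: finite_edges, auto simp: edges_def)
  also have "sum (case_prod N) (edges m) + \<dots> =
      (\<Sum>e\<in>edges m. (if fst e = snd e then 1 else 2) * case_prod N e)"
    unfolding sum.distrib[symmetric] by (rule sum.cong) auto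
  finally show ?thesis .
qed

lemma card_odd_diagonal:
  "card {i \<in> {..m}. odd (N i i)} = (\<Sum>e\<in>edges m. if fst e = snd e then N (fst e) (fst e) mod 2 else 0)"
proof -
  have "card {i \<in> {..m}. odd (N i i)} = (\<Sum>i\<in>{..m}. N i i mod 2)"
    unfolding card_eq_sum by (rule sum.mono_neutral_cong_left) (auto simp: odd_iff_mod_2_eq_one)
  also have "\<dots> = (\<Sum>e\<in>(\<lambda>i. (i, i)) ` {..m}. N (fst e) (fst e) mod 2)"
    by (subst sum.reindex) (auto intro: inj_onI)
  also have "\<dots> = (\<Sum>e\<in>edges m. if fst e = snd e then N (fst e) (fst e) mod 2 else 0)"
    by (intro sum.mono_neutral_cong_left finite_edges) (auto simp: edges_def)
  finally show ?thesis .
qed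

lemma card_fixed_points:
  assumes \<sigma>: "\<sigma> \<in> involutions n" and a: "a \<in> labelings n \<sigma> m"
  shows "card {k \<in> {1..n}. \<sigma> k = k} = card {i \<in> {..m}. odd (type_matrix n \<sigma> a i i)}"
proof -
  let ?N = "type_matrix n \<sigma> a" and ?e = "cell_of n \<sigma> m a"
  note bij = bij_betw_cell_of[OF \<sigma> a]
  have inj: "inj_on ?e {1..n}" and img: "?e ` {1..n} = cells m ?N"
    using bij by (auto simp: bij_betw_def)
  have fix_iff: "\<sigma> k = k \<longleftrightarrow> flip m ?N (?e k) = ?e k" if "k \<in> {1..n}" for k
    using cell_of_involution[OF \<sigma> a that] inj_on_eq_iff[OF inj involutionsD(3)[OF \<sigma> that] that]
    by simp
  have fixed: "?e ` {k \<in> {1..n}. \<sigma> k = k} = {p \<in> cells m ?N. flip m ?N p = p}"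
    unfolding img[symmetric] using fix_iff by (auto simp del: atLeastAtMost_iff)
  have "inj_on ?e {k \<in> {1..n}. \<sigma> k = k}"
    by (rule inj_on_subset[OF inj]) blast
  then have "card {k \<in> {1..n}. \<sigma> k = k} = card {p \<in> cells m ?N. flip m ?N p = p}"
    unfolding fixed[symmetric] by (rule card_image[symmetric])
  then show ?thesis
    by (simp only: card_flip_fixed)
qed

text \<open>
  The entry sum \<open>n\<close> splits into twice the exponents in \<open>edge_sign\<close> plus the number of odd diagonal
  entries. The latter is the number of fixed points, so the exponents add up to the number of
  2-cycles.
\<close>

lemma sign_eq_prod_edge_sign:
  assumes \<sigma>: "\<sigma> \<in> involutions n" and a: "a \<in> labelings n \<sigma> m"
  shows "sign \<sigma> = (\<Prod>e\<in>edges m. edge_sign e (case_prod (type_matrix n \<sigma> a) e))"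
proof -
  define N where "N = type_matrix n \<sigma> a"
  let ?h = "\<lambda>e. if fst e = snd e then case_prod N e div 2 else case_prod N e"
  have sym: "N i j = N j i" for i j
    unfolding N_def using \<sigma> by (rule type_matrix_symmetric)
  have "n = (\<Sum>i\<le>m. \<Sum>j\<le>m. N i j)"
    using type_matrix_in_symmetric_matrices[OF assms] by (simp add: symmetric_matrices_def N_def)
  also have "\<dots> = (\<Sum>e\<in>edges m. 2 * ?h e + (if fst e = snd e then N (fst e) (fst e) mod 2 else 0))"
    unfolding sum_symmetric_matrix[OF sym] by (rule sum.cong) auto
  also have "\<dots> = 2 * sum ?h (edges m) + card {i \<in> {..m}. odd (N i i)}"
    unfolding sum.distrib sum_distrib_left card_odd_diagonal ..
  also have "card {i \<in> {..m}. odd (N i i)} = card {k \<in> {1..n}. \<sigma> k = k}"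
    using card_fixed_points[OF assms] by (simp add: N_def)
  finally have n: "n = 2 * sum ?h (edges m) + card {k \<in> {1..n}. \<sigma> k = k}" .
  have supp: "{k. \<sigma> k \<noteq> k} = {1..n} - {k \<in> {1..n}. \<sigma> k = k}"
    using permutes_not_in[OF involutionsD(1)[OF \<sigma>]] by blast
  have "card {k. \<sigma> k \<noteq> k} = card {1..n} - card {k \<in> {1..n}. \<sigma> k = k}"
    unfolding supp by (rule card_Diff_subset) auto
  then have "card {k. \<sigma> k \<noteq> k} = n - card {k \<in> {1..n}. \<sigma> k = k}"
    by (simp only: card_atLeastAtMost diff_Suc_1)
  with n have moved: "card {k. \<sigma> k \<noteq> k} = 2 * sum ?h (edges m)"
    by linarith
  have "permutation \<sigma>"
    using involutionsD(1)[OF \<sigma>] by (auto simp: permutation_permutes)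
  then have "sign \<sigma> = (-1) ^ (card {k. \<sigma> k \<noteq> k} div 2)"
    using \<sigma> by (intro sign_involution) (auto simp: involutions_def)
  also have "\<dots> = (\<Prod>e\<in>edges m. (-1) ^ ?h e)"
    by (simp add: moved power_sum)
  also have "\<dots> = (\<Prod>e\<in>edges m. edge_sign e (case_prod N e))"
    by (simp add: edge_sign_def)
  finally show ?thesis
    by (simp add: N_def)
qed

section \<open>The generating function of symmetric matrices\<close>

text \<open>
  Multiplicity functions on \<open>E\<close> of total weight \<open>n\<close>, where each copy of \<open>e\<close> weighs \<open>d e\<close>. They
  vanish outside \<open>E\<close> so that each multiset over \<open>E\<close> is represented once.
\<close>

definition weighted_multiplicities :: "('e \<Rightarrow> nat) \<Rightarrow> 'e set \<Rightarrow> nat \<Rightarrow> ('e \<Rightarrow> nat) set" where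
  "weighted_multiplicities d E n = {c. (\<forall>e. e \<notin> E \<longrightarrow> c e = 0) \<and> (\<Sum>e\<in>E. d e * c e) = n}"

lemma finite_weighted_multiplicities:
  assumes "finite E" "\<And>e. 0 < d e"
  shows "finite (weighted_multiplicities d E n)"
proof (rule finite_subset)
  show "weighted_multiplicities d E n \<subseteq> {c. \<forall>e. (e \<in> E \<longrightarrow> c e \<in> {..n}) \<and> (e \<notin> E \<longrightarrow> c e = 0)}"
  proof
    fix c assume c: "c \<in> weighted_multiplicities d E n"
    have "c e \<le> n" if "e \<in> E" for e
    proof -
      have "c e \<le> d e * c e"
        using assms(2)[of e] by simp
      also have "\<dots> \<le> (\<Sum>e\<in>E. d e * c e)"
        using that assms(1) by (intro member_le_sum) auto
      finally show ?thesis
        using c by (simp add: weighted_multiplicities_def)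
    qed
    then show "c \<in> {c. \<forall>e. (e \<in> E \<longrightarrow> c e \<in> {..n}) \<and> (e \<notin> E \<longrightarrow> c e = 0)}"
      using c by (simp add: weighted_multiplicities_def)
  qed
  show "finite {c. \<forall>e. (e \<in> E \<longrightarrow> c e \<in> {..n}) \<and> (e \<notin> E \<longrightarrow> c e = (0::nat))}"
    by (intro finite_set_of_finite_funs assms(1)) simp
qed

text \<open>
  The series \<open>\<Sum>q. s q * X ^ (d * q)\<close>.
\<close>

definition spread_series :: "nat \<Rightarrow> (nat \<Rightarrow> 'a::comm_ring_1) \<Rightarrow> 'a fps" where
  "spread_series d s = Abs_fps (\<lambda>k. if d dvd k then s (k div d) else 0)"

lemma spread_series_mult_nth:
  assumes "0 < d"
  shows "(spread_series d s * f) $ n = (\<Sum>q | d * q \<le> n. s q * f $ (n - d * q))"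
proof -
  have "(spread_series d s * f) $ n = (\<Sum>k\<in>{..n}. (if d dvd k then s (k div d) else 0) * f $ (n - k))"
    by (simp add: fps_mult_nth spread_series_def atLeast0AtMost)
  also have "\<dots> = (\<Sum>k\<in>(\<lambda>q. d * q) ` {q. d * q \<le> n}. s (k div d) * f $ (n - k))"
    by (rule sum.mono_neutral_cong_right) (auto elim!: dvdE)
  also have "\<dots> = (\<Sum>q | d * q \<le> n. s q * f $ (n - d * q))"
    using assms by (subst sum.reindex) (auto intro!: inj_onI)
  finally show ?thesis .
qed

text \<open>
  Expanding the product: a term of total degree \<open>n\<close> chooses an exponent \<open>d e * c e\<close> in each factor.
\<close>

lemma prod_spread_series_nth:
  fixes s :: "'e \<Rightarrow> nat \<Rightarrow> 'a::comm_ring_1"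
  assumes "finite E" "\<And>e. 0 < d e"
  shows "(\<Prod>e\<in>E. spread_series (d e) (s e)) $ n =
    (\<Sum>c\<in>weighted_multiplicities d E n. \<Prod>e\<in>E. s e (c e))"
  using assms(1)
proof (induction E arbitrary: n rule: finite_induct)
  case empty
  have "weighted_multiplicities d {} n = (if n = 0 then {\<lambda>_. 0} else {})"
    by (auto simp: weighted_multiplicities_def)
  then show ?case by simp
next
  case (insert x E)
  let ?Q = "{q. d x * q \<le> n}"
  have "?Q \<subseteq> {..n}"
  proof
    fix q assume "q \<in> ?Q"
    moreover have "q \<le> d x * q"
      using assms(2)[of x] by (cases "d x") simp_all
    ultimately have "q \<le> n"
      using order_trans by blast
    then show "q \<in> {..n}" by simp
  qed
  then have finQ: "finite ?Q" by (rule finite_subset) simp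
  have split: "(\<Sum>e\<in>insert x E. d e * c e) = d x * c x + (\<Sum>e\<in>E. d e * c e)" for c :: "'e \<Rightarrow> nat"
    using insert by simp
  have upd: "(\<Sum>e\<in>E. d e * (c(x := k)) e) = (\<Sum>e\<in>E. d e * c e)" for c :: "'e \<Rightarrow> nat" and k
    using insert by (intro sum.cong) auto
  have upd': "(\<Prod>e\<in>E. s e ((c(x := k)) e)) = (\<Prod>e\<in>E. s e (c e))" for c :: "'e \<Rightarrow> nat" and k
    using insert by (intro prod.cong) auto
  have "(\<Prod>e\<in>insert x E. spread_series (d e) (s e)) $ n =
      (\<Sum>q\<in>?Q. \<Sum>c\<in>weighted_multiplicities d E (n - d x * q). s x q * (\<Prod>e\<in>E. s e (c e)))"
    using insert by (simp add: spread_series_mult_nth[OF assms(2)] sum_distrib_left)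
  also have "\<dots> = (\<Sum>(q, c)\<in>(SIGMA q:?Q. weighted_multiplicities d E (n - d x * q)).
      s x q * (\<Prod>e\<in>E. s e (c e)))"
    using finQ insert(1) assms(2)
    by (intro sum.Sigma) (auto intro: finite_weighted_multiplicities)
  also have "\<dots> = (\<Sum>c\<in>weighted_multiplicities d (insert x E) n. \<Prod>e\<in>insert x E. s e (c e))"
  proof (rule sum.reindex_bij_witness[of _ "\<lambda>c. (c x, c(x := 0))" "\<lambda>(q, c). c(x := q)"])
    fix p assume p: "p \<in> (SIGMA q:?Q. weighted_multiplicities d E (n - d x * q))"
    obtain q c where qc: "p = (q, c)" by (cases p)
    have c: "d x * q \<le> n" "\<And>e. e \<notin> E \<Longrightarrow> c e = 0" "(\<Sum>e\<in>E. d e * c e) = n - d x * q"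
      using p by (auto simp: qc weighted_multiplicities_def)
    show "(((case p of (q, c) \<Rightarrow> c(x := q)) x), (case p of (q, c) \<Rightarrow> c(x := q))(x := 0)) = p"
      using c(2)[OF insert(2)] by (auto simp: qc)
    show "(case p of (q, c) \<Rightarrow> c(x := q)) \<in> weighted_multiplicities d (insert x E) n"
      unfolding qc prod.case weighted_multiplicities_def mem_Collect_eq split upd
      using c by auto
    show "(\<Prod>e\<in>insert x E. s e ((case p of (q, c) \<Rightarrow> c(x := q)) e)) =
        (case p of (q, c) \<Rightarrow> s x q * (\<Prod>e\<in>E. s e (c e)))"
      using insert by (simp add: qc upd' del: fun_upd_apply) simp
  next
    fix c assume c: "c \<in> weighted_multiplicities d (insert x E) n"
    then show "(c x, c(x := 0)) \<in> (SIGMA q:?Q. weighted_multiplicities d E (n - d x * q))"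
      by (auto simp: weighted_multiplicities_def split upd simp del: fun_upd_apply) auto
  qed auto
  finally show ?case .
qed

text \<open>
  An off-diagonal entry occurs twice in the entry sum of a symmetric matrix.
\<close>

abbreviation edge_size :: "nat \<times> nat \<Rightarrow> nat" where
  "edge_size e \<equiv> (if fst e = snd e then 1 else 2)"

lemma bij_betw_edge_multiplicities:
  "bij_betw (\<lambda>c i j. c (min i j, max i j)) (weighted_multiplicities edge_size (edges m) n)
     (symmetric_matrices m n)"
proof (rule bij_betw_byWitness[where f' = "\<lambda>N e. if e \<in> edges m then case_prod N e else 0"])
  have fold_edges: "(\<Sum>e\<in>edges m. edge_size e * c (min (fst e) (snd e), max (fst e) (snd e))) =
      (\<Sum>e\<in>edges m. edge_size e * c e)" for c :: "nat \<times> nat \<Rightarrow> nat"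
    by (rule sum.cong) (auto simp: edges_def min_def max_def)
  show "(\<lambda>c i j. c (min i j, max i j)) ` weighted_multiplicities edge_size (edges m) n
      \<subseteq> symmetric_matrices m n"
  proof (rule image_subsetI)
    fix c assume c: "c \<in> weighted_multiplicities edge_size (edges m) n"
    define N where "N i j = c (min i j, max i j)" for i j
    have sym: "N i j = N j i" for i j
      by (simp add: N_def min.commute max.commute)
    have "(\<Sum>i\<le>m. \<Sum>j\<le>m. N i j) = n"
      using c fold_edges[of c] unfolding sum_symmetric_matrix[OF sym]
      by (simp add: N_def case_prod_unfold weighted_multiplicities_def)
    moreover have "N i j = 0" if "m < i" for i j
      using c that by (auto simp: N_def weighted_multiplicities_def edges_def)
    ultimately have "N \<in> symmetric_matrices m n"
      using sym by (simp add: symmetric_matrices_def)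
    then show "(\<lambda>i j. c (min i j, max i j)) \<in> symmetric_matrices m n"
      by (simp add: N_def[abs_def])
  qed
  show "(\<lambda>N e. if e \<in> edges m then case_prod N e else 0) ` symmetric_matrices m n
      \<subseteq> weighted_multiplicities edge_size (edges m) n"
  proof (rule image_subsetI)
    fix N assume N: "N \<in> symmetric_matrices m n"
    note sym = symmetric_matricesD(1)[OF N]
    show "(\<lambda>e. if e \<in> edges m then case_prod N e else 0) \<in> weighted_multiplicities edge_size (edges m) n"
      using symmetric_matricesD(3)[OF N] sum_symmetric_matrix[where m = m, OF sym]
      by (simp add: weighted_multiplicities_def)
  qed
  show "\<forall>c\<in>weighted_multiplicities edge_size (edges m) n.
      (\<lambda>e. if e \<in> edges m then case_prod (\<lambda>i j. c (min i j, max i j)) e else 0) = c"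
    by (auto simp: weighted_multiplicities_def edges_def fun_eq_iff min_def max_def)
  show "\<forall>N\<in>symmetric_matrices m n.
      (\<lambda>i j. if (min i j, max i j) \<in> edges m then case_prod N (min i j, max i j) else 0) = N"
  proof
    fix N assume N: "N \<in> symmetric_matrices m n"
    show "(\<lambda>i j. if (min i j, max i j) \<in> edges m then case_prod N (min i j, max i j) else 0) = N"
    proof (intro ext)
      fix i j show "(if (min i j, max i j) \<in> edges m then case_prod N (min i j, max i j) else 0) = N i j"
        using symmetric_matricesD(1,2)[OF N, of i j] by (auto simp: edges_def min_def max_def)
    qed
  qed
qed

definition matrix_series :: "nat \<Rightarrow> rat fps" where
  "matrix_series m = (\<Prod>e\<in>edges m. spread_series (edge_size e) (\<lambda>k. of_int (edge_sign e k)))"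

lemma matrix_series_nth:
  "matrix_series m $ n = (\<Sum>N\<in>symmetric_matrices m n. of_int (\<Prod>e\<in>edges m. edge_sign e (case_prod N e)))"
proof -
  have "matrix_series m $ n = (\<Sum>c\<in>weighted_multiplicities edge_size (edges m) n.
      \<Prod>e\<in>edges m. of_int (edge_sign e (c e)))"
    unfolding matrix_series_def by (rule prod_spread_series_nth) (auto simp: finite_edges)
  also have "\<dots> = (\<Sum>c\<in>weighted_multiplicities edge_size (edges m) n.
      of_int (\<Prod>e\<in>edges m. edge_sign e (case_prod (\<lambda>i j. c (min i j, max i j)) e)))"
    by (intro sum.cong refl) (auto simp: edges_def min_def max_def intro!: prod.cong)
  also have "\<dots> = (\<Sum>N\<in>symmetric_matrices m n. of_int (\<Prod>e\<in>edges m. edge_sign e (case_prod N e)))"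
    by (rule sum.reindex_bij_betw[OF bij_betw_edge_multiplicities])
  finally show ?thesis .
qed

lemma card_edges: "card (edges m) = (m + 2) choose 2"
proof (induction m)
  case 0
  have "edges 0 = {(0, 0)}" by (auto simp: edges_def)
  then show ?case by (simp add: numeral_2_eq_2)
next
  case (Suc m)
  have "edges (Suc m) = edges m \<union> (\<lambda>i. (i, Suc m)) ` {..Suc m}"
    by (auto simp: edges_def le_Suc_eq)
  moreover have "card (edges m \<union> (\<lambda>i. (i, Suc m)) ` {..Suc m}) =
      card (edges m) + card ((\<lambda>i. (i, Suc m)) ` {..Suc m})"
    by (intro card_Un_disjoint finite_edges) (auto simp: edges_def)
  moreover have "card ((\<lambda>i. (i, Suc m)) ` {..Suc m}) = m + 2"
    by (subst card_image) (auto intro: inj_onI)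
  moreover have "(Suc m + 2) choose 2 = (m + 2) + ((m + 2) choose 2)"
    by (simp add: numeral_2_eq_2)
  ultimately show ?case
    using Suc by simp
qed

text \<open>
  Coefficients two degrees apart are negatives of each other: on the diagonal because the number
  of 2-cycles grows by one with every second unit, off the diagonal because each unit has degree
  two. Hence multiplication by \<open>1 + fps_X ^ 2\<close> leaves only the terms of degree less than two.
\<close>

lemma edge_series_mult:
  "(1 + fps_X ^ 2) * spread_series (edge_size e) (\<lambda>k. of_int (edge_sign e k)) =
     (if fst e = snd e then 1 + fps_X else (1 :: rat fps))"
proof (rule fps_ext)
  fix n :: nat
  consider "n = 0" | "n = 1" | k where "n = k + 2"
    by (metis One_nat_def add_2_eq_Suc' not0_implies_Suc)
  then show "((1 + fps_X ^ 2) * spread_series (edge_size e) (\<lambda>k. of_int (edge_sign e k))) $ n =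
     (if fst e = snd e then 1 + fps_X else (1 :: rat fps)) $ n"
    by cases (auto simp: distrib_right fps_X_power_mult_nth spread_series_def edge_sign_def)
qed

lemma matrix_series_closed_form:
  "(1 + fps_X ^ 2) ^ ((m + 2) choose 2) * matrix_series m = (1 + fps_X) ^ (m + 1)"
proof -
  have "(1 + fps_X ^ 2) ^ ((m + 2) choose 2) * matrix_series m =
      (\<Prod>e\<in>edges m. (1 + fps_X ^ 2) * spread_series (edge_size e) (\<lambda>k. of_int (edge_sign e k)))"
    by (simp add: matrix_series_def prod.distrib card_edges)
  also have "\<dots> = (\<Prod>e\<in>edges m. if fst e = snd e then 1 + fps_X else 1)"
    by (simp only: edge_series_mult)
  also have "\<dots> = (\<Prod>e\<in>(\<lambda>i. (i, i)) ` {..m}. 1 + fps_X)"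
    by (intro prod.mono_neutral_cong_right finite_edges) (auto simp: edges_def)
  also have "\<dots> = (1 + fps_X) ^ (m + 1)"
    by (subst prod.reindex) (auto intro: inj_onI)
  finally show ?thesis .
qed

section \<open>Coefficient comparison\<close>

lemma finite_involutions: "finite (involutions n)"
  by (rule finite_subset[of _ "{\<sigma>. \<sigma> permutes {1..n}}"])
    (auto simp: involutions_def finite_permutations)

lemma signed_labelings_eq_matrix_series:
  "(\<Sum>\<sigma>\<in>involutions n. of_int (sign \<sigma>) * of_nat (card (labelings n \<sigma> m))) = matrix_series m $ n"
proof -
  have "(\<Sum>\<sigma>\<in>involutions n. of_int (sign \<sigma>) * of_nat (card (labelings n \<sigma> m))) =
      (\<Sum>\<sigma>\<in>involutions n. \<Sum>a\<in>labelings n \<sigma> m. of_int (sign \<sigma>) :: rat)"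
    by (simp add: mult.commute)
  also have "\<dots> = (\<Sum>(\<sigma>, a)\<in>(SIGMA \<sigma>:involutions n. labelings n \<sigma> m). of_int (sign \<sigma>))"
    by (rule sum.Sigma) (auto simp: finite_involutions finite_labelings)
  also have "\<dots> = (\<Sum>p\<in>(SIGMA \<sigma>:involutions n. labelings n \<sigma> m).
      of_int (\<Prod>e\<in>edges m. edge_sign e (case_prod (case p of (\<sigma>, a) \<Rightarrow> type_matrix n \<sigma> a) e)))"
    by (rule sum.cong) (auto simp: sign_eq_prod_edge_sign)
  also have "\<dots> = (\<Sum>N\<in>symmetric_matrices m n. of_int (\<Prod>e\<in>edges m. edge_sign e (case_prod N e)))"
    by (rule sum.reindex_bij_betw[OF bij_betw_type_matrix])
  finally show ?thesis
    by (simp add: matrix_series_nth)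
qed

text \<open>
  The sum on the right is the signed Eulerian polynomial; so the factor of \<open>u ^ n\<close> in the left-hand
  side of the identity collects the coefficients of \<open>u ^ n\<close> in all the matrix series.
\<close>

lemma signed_eulerian_inv_series:
  "(1 - fps_X) ^ Suc n * Abs_fps (\<lambda>m. matrix_series m $ n) =
     (\<Sum>\<sigma>\<in>involutions n. of_int (sign \<sigma>) * fps_X ^ ris n \<sigma>)"
proof -
  have "Abs_fps (\<lambda>m. matrix_series m $ n) =
      (\<Sum>\<sigma>\<in>involutions n. of_int (sign \<sigma>) * Abs_fps (\<lambda>m. of_nat (card (labelings n \<sigma> m))))"
    by (rule fps_ext)
      (simp add: fps_sum_nth fps_of_int[symmetric] flip: signed_labelings_eq_matrix_series)
  then show ?thesis
    by (simp only: sum_distrib_left mult.left_commute[of "(1 - fps_X) ^ Suc n"]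
        labelings_generating_function)
qed

lemma poly_signed_eulerian_inv:
  "poly (map_poly of_int (signed_eulerian_inv n)) x =
     (\<Sum>\<sigma>\<in>involutions n. of_int (sign \<sigma>) * (x :: 'a::comm_ring_1) ^ ris n \<sigma>)"
proof -
  have "map_poly of_int (signed_eulerian_inv n) =
      (\<Sum>\<sigma>\<in>involutions n. monom (of_int (sign \<sigma>) :: 'a) (ris n \<sigma>))"
    by (rule poly_eqI) (auto simp: signed_eulerian_inv_def coeff_map_poly coeff_sum intro!: sum.cong)
  then show ?thesis
    by (simp add: poly_sum poly_monom)
qed

text \<open>
  Embeds series in \<open>u\<close> with constant coefficients into the bivariate series; it is a ring
  homomorphism, which transports the closed form of \<open>matrix_series\<close>.
\<close>

definition lift_fps :: "'a::comm_ring_1 fps \<Rightarrow> 'a fps fps" where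
  "lift_fps f = Abs_fps (\<lambda>i. fps_const (f $ i))"

lemma fps_const_sum: "fps_const (sum f A) = (\<Sum>x\<in>A. fps_const (f x))"
  by (induction A rule: infinite_finite_induct) (auto simp flip: fps_const_add)

lemma lift_fps_mult: "lift_fps (f * g) = lift_fps f * lift_fps g"
  by (rule fps_ext) (simp add: lift_fps_def fps_mult_nth fps_const_sum)

lemma lift_fps_add: "lift_fps (f + g) = lift_fps f + lift_fps g"
  by (rule fps_ext) (simp add: lift_fps_def)

lemma lift_fps_1: "lift_fps 1 = 1"
  by (rule fps_ext) (simp add: lift_fps_def)

lemma lift_fps_X: "lift_fps fps_X = fps_X"
  by (rule fps_ext) (simp add: lift_fps_def fps_X_def)

lemma lift_fps_power: "lift_fps (f ^ n) = lift_fps f ^ n"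
  by (induction n) (simp_all add: lift_fps_1 lift_fps_mult)

lemma bifps_divide_eqI:
  fixes f g h :: bifps
  assumes "g $ 0 $ 0 \<noteq> 0" "h * g = f"
  shows "f / g = h"
proof -
  have "f / g * g = h * g"
    using assms by (simp add: bifps_divide_mult_cancel)
  moreover have "g \<noteq> 0" using assms(1) by auto
  ultimately show ?thesis by simp
qed

text \<open>
  The term of index \<open>n\<close> has only monomials with \<open>u ^ n\<close>. The terms of the other family,
  treated in \<open>matrix_term_nth\<close>, are separated by the power of \<open>t\<close> instead. So in both families
  each monomial occurs in at most one member.
\<close>

lemma eulerian_term_nth:
  "(poly (map_poly of_int (signed_eulerian_inv n)) var_t * (var_u ^ n / (1 - var_t) ^ (n + 1))) $ i $ j =
     (if n = i then matrix_series j $ i else 0)"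
proof -
  let ?D = "(1 - fps_X) ^ Suc n :: rat fps" and ?L = "Abs_fps (\<lambda>m. matrix_series m $ n)"
  have D: "(1 - var_t) ^ (n + 1) = fps_const ?D"
    by (simp only: var_t_def fps_const_power[symmetric] fps_const_sub[symmetric]
        fps_const_1_eq_1 Suc_eq_plus1)
  have D0: "?D $ 0 = 1"
    by (simp add: fps_power_zeroth)
  have inv: "inverse ?D * ?D = 1"
    by (rule inverse_mult_eq_1) (simp add: D0)
  have "var_u ^ n / (1 - var_t) ^ (n + 1) = fps_const (inverse ?D) * fps_X ^ n"
  proof (rule bifps_divide_eqI)
    show "(1 - var_t) ^ (n + 1) $ 0 $ 0 \<noteq> (0 :: rat)"
      unfolding D using D0 by simp
    have "fps_const (inverse ?D) * fps_X ^ n * fps_const ?D = fps_const (inverse ?D * ?D) * fps_X ^ n"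
      by (simp only: fps_const_mult[symmetric] mult_ac)
    then show "fps_const (inverse ?D) * fps_X ^ n * (1 - var_t) ^ (n + 1) = var_u ^ n"
      by (simp only: D var_u_def inv fps_const_1_eq_1 mult_1)
  qed
  moreover have "poly (map_poly of_int (signed_eulerian_inv n)) var_t = fps_const (?D * ?L)"
    unfolding signed_eulerian_inv_series poly_signed_eulerian_inv
    by (simp only: var_t_def fps_of_int fps_const_sum fps_const_mult[symmetric]
        fps_const_power[symmetric])
  ultimately have "poly (map_poly of_int (signed_eulerian_inv n)) var_t * (var_u ^ n / (1 - var_t) ^ (n + 1)) =
      fps_const (inverse ?D * ?D * ?L) * fps_X ^ n"
    by (simp only: fps_const_mult[symmetric] mult_ac)
  then have "poly (map_poly of_int (signed_eulerian_inv n)) var_t * (var_u ^ n / (1 - var_t) ^ (n + 1)) =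
      fps_const ?L * fps_X ^ n"
    by (simp only: inv mult_1)
  then show ?thesis
    by (simp add: fps_X_power_nth)
qed

lemma matrix_term_nth:
  "(var_t ^ m * ((1 + var_u) ^ (m + 1) / (1 + var_u ^ 2) ^ ((m + 2) choose 2))) $ i $ j =
     (if m = j then matrix_series j $ i else 0)"
proof -
  have "(1 + var_u) ^ (m + 1) / (1 + var_u ^ 2) ^ ((m + 2) choose 2) = lift_fps (matrix_series m)"
  proof (rule bifps_divide_eqI)
    show "(1 + var_u ^ 2) ^ ((m + 2) choose 2) $ 0 $ 0 \<noteq> (0 :: rat)"
      by (simp add: var_u_def fps_power_zeroth)
    have "lift_fps ((1 + fps_X ^ 2) ^ ((m + 2) choose 2) * matrix_series m) =
        lift_fps ((1 + fps_X) ^ (m + 1))"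
      by (simp only: matrix_series_closed_form)
    then show "lift_fps (matrix_series m) * (1 + var_u ^ 2) ^ ((m + 2) choose 2) = (1 + var_u) ^ (m + 1)"
      by (simp only: lift_fps_mult lift_fps_add lift_fps_1 lift_fps_X lift_fps_power var_u_def
          mult.commute)
  qed
  then show ?thesis
    by (simp add: var_t_def lift_fps_def fps_X_power_mult_nth fps_const_power)
qed

lemma bifps_suminf_single:
  assumes "\<And>n i j. f n $ i $ j = (if n = k i j then h i j else 0)"
  shows "bifps_summable f" "bifps_suminf f $ i $ j = h i j"
proof -
  have supp: "{n. f n $ i $ j \<noteq> 0} = (if h i j = 0 then {} else {k i j})" for i j
    by (auto simp: assms)
  show "bifps_summable f"
    by (simp add: bifps_summable_def supp)
  show "bifps_suminf f $ i $ j = h i j"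
    by (simp add: bifps_suminf_def supp) (simp add: assms)
qed

theorem theorem4:
  shows "bifps_summable (\<lambda>n. poly (map_poly of_int (signed_eulerian_inv n)) var_t
           * (var_u ^ n / (1 - var_t) ^ (n + 1)))
       \<and> bifps_summable (\<lambda>m. var_t ^ m
           * ((1 + var_u) ^ (m + 1) / (1 + var_u ^ 2) ^ ((m + 2) choose 2)))
       \<and> bifps_suminf (\<lambda>n. poly (map_poly of_int (signed_eulerian_inv n)) var_t
           * (var_u ^ n / (1 - var_t) ^ (n + 1)))
         = bifps_suminf (\<lambda>m. var_t ^ m
           * ((1 + var_u) ^ (m + 1) / (1 + var_u ^ 2) ^ ((m + 2) choose 2)))"
proof -
  note L = bifps_suminf_single[where k = "\<lambda>i j. i", OF eulerian_term_nth]
  note R = bifps_suminf_single[where k = "\<lambda>i j. j", OF matrix_term_nth]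
  show ?thesis
    using L(1) R(1) by (simp only: fps_eq_iff L(2) R(2) simp_thms)
qed

end
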